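(* Let $m\ge2$ and $n\ge1$ be integers. The elements of the set $\mathcal{N}_{n-\delta_{m,2}}\setminus\mathcal{N}_{n-1-\delta_{m,2}}$ are of the form $x^\Lambda\partial_k\in\mathcal{B}$, where $\Lambda\in\mathcal{P}_m(n-1)$ is a partition of $k+1$ which is unrefinable in $\mathcal{P}_m$ and such that $x^\Lambda\partial_k$ satisfies the first excludant condition.
   Context: $\mathbb{Z}_m$ denotes the integers modulo $m$, and $\delta_{m,2}$ is the Kronecker delta. A partition is a finitely supported sequence $\Lambda=(\lambda_i)_{i\ge1}$ of non-negative integers ($\lambda_i$ is the multiplicity of the part $i$); it is a partition of its weight $\mathrm{wt}(\Lambda)=\sum_i i\lambda_i$. For $j\ge 0$, $\mathcal{P}_m(j)$ is the set of partitions with all parts at most $j$ and all multiplicities at most $m-1$ (it contains the empty partition), and $\mathcal{P}_m=\bigcup_j\mathcal{P}_m(j)$. Write $x^\Lambda=\prod_i x_i^{\lambda_i}$, regarded in the ring $\mathcal{O}_m(n)=\mathbb{Z}_m[x_1,\dots,x_n]/(x_1^m,\dots,x_n^m)$, on which the partial derivatives $\partial_k$ act as derivations. The Lie ring of partitions $\mathfrak{L}=\mathfrak{L}(n)$ is the free $\mathbb{Z}_m$-module with basis $\mathcal{B}=\{x^\Lambda\partial_k \mid 1\le k\le n,\ \Lambda\in\mathcal{P}_m(k-1)\}$, and Lie bracket determined bilinearly by $[x^\Lambda\partial_k,x^\Theta\partial_j]=\partial_j(x^\Lambda)x^\Theta\partial_k-x^\Lambda\partial_k(x^\Theta)\partial_j$.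 For $\mathcal{H}\subseteq\mathcal{B}$ put $\mathbb{Z}_m\mathcal{H}=\{ah\mid a\in\mathbb{Z}_m,\ h\in\mathcal{H}\}$ (scalar multiples of elements of $\mathcal{H}$) and $N_{\mathcal{B}}(\mathcal{H})=\{b\in\mathcal{B}\mid [b,h]\in\mathbb{Z}_m\mathcal{H}\ \forall h\in\mathcal{H}\}$. Define $\mathcal{N}_{-1}=\mathcal{T}=\{\partial_1,\dots,\partial_n\}$ and $\mathcal{N}_i=N_{\mathcal{B}}(\mathcal{N}_{i-1})$ for all $i\ge0$. Refinability: $\Lambda\in\mathcal{P}_m$ is refinable in $\mathcal{P}_m$ if there exist $j$ with $\lambda_j\ge1$, indices $j_1<\dots<j_\ell<j$ and positive integers $a_1,\dots,a_\ell$ with $a_i\le m-1-\lambda_{j_i}$ and $j=\sum_{i=1}^\ell a_ij_i$ (so that one occurrence of the part $j$ can be replaced by $a_i$ copies of each $j_i$, staying in $\mathcal{P}_m$); otherwise $\Lambda$ is unrefinable in $\mathcal{P}_m$. Excludants: for $\Lambda\in\mathcal{P}_m(n-1)$ write $\left(\prod_{i=1}^{n-1}x_i^{m-1}\right)/x^\Lambda=x_{e_1}^{\mu_1}\cdots x_{e_s}^{\mu_s}$ with $e_1<\dots<e_s$ and all $\mu_i\ge1$ (quotient of monomials); $e_i$ is the $i$-th excludant of $\Lambda$. The element $x^\Lambda\partial_k$ satisfies the $i$-th excludant condition if $i$ is the minimum index such that $n<k+e_i$; in particular the first excludant condition says $n<k+e_1$.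
   Formalization: If Λ has no excludants (all of 1,…,n-1 with multiplicity m-1), e_1 is undefined; here e_1 = n by convention. This matters only for m = 4, n = 2, where x_1^3∂_2 lies in N_2 \ N_1 but has no excludant. The claim is proved as a set equality. *)

theory Defs
  imports "HOL-Library.Poly_Mapping" "Berlekamp_Zassenhaus.Finite_Field"
begin

section \<open>Partitions with bounded multiplicities\<close>

text \<open>A partition is identified with its finitely supported sequence of multiplicities:
  \<open>lookup \<Lambda> i\<close> is the multiplicity of the part \<open>i\<close>. Parts are positive, so index \<open>0\<close> never
  lies in the support.\<close>

type_synonym partition = "nat \<Rightarrow>\<^sub>0 nat"

definition wt :: "partition \<Rightarrow> nat" where
  "wt \<Lambda> = (\<Sum>i\<in>Poly_Mapping.keys \<Lambda>. i * Poly_Mapping.lookup \<Lambda> i)"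

definition partitions_upto :: "nat \<Rightarrow> nat \<Rightarrow> partition set" where
  "partitions_upto m j =
     {\<Lambda>. Poly_Mapping.keys \<Lambda> \<subseteq> {1..j} \<and> (\<forall>i. Poly_Mapping.lookup \<Lambda> i \<le> m - 1)}"

definition partitions :: "nat \<Rightarrow> partition set" where
  "partitions m = (\<Union>j. partitions_upto m j)"

text \<open>The set \<open>J\<close> is \<open>{j\<^sub>1 < \<dots> < j\<^sub>\<ell>}\<close>.\<close>

definition refinable :: "nat \<Rightarrow> partition \<Rightarrow> bool" where
  "refinable m \<Lambda> \<longleftrightarrow> \<Lambda> \<in> partitions m \<and>
     (\<exists>j. Poly_Mapping.lookup \<Lambda> j \<ge> 1 \<and>
       (\<exists>J\<subseteq>{1..<j}. \<exists>a :: nat \<Rightarrow> nat.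
          (\<forall>i\<in>J. 1 \<le> a i \<and> a i \<le> m - 1 - Poly_Mapping.lookup \<Lambda> i) \<and>
          j = (\<Sum>i\<in>J. a i * i)))"

definition unrefinable :: "nat \<Rightarrow> partition \<Rightarrow> bool" where
  "unrefinable m \<Lambda> \<longleftrightarrow> \<Lambda> \<in> partitions m \<and> \<not> refinable m \<Lambda>"

text \<open>The exponent of the monomial \<open>(\<Prod>i=1..n-1. x\<^sub>i ^ (m-1)) / x\<^sup>\<Lambda>\<close>, and the increasing list
  of the indices of the variables occurring in it.\<close>

definition complement :: "nat \<Rightarrow> nat \<Rightarrow> partition \<Rightarrow> partition" where
  "complement m n \<Lambda> = (\<Sum>i\<in>{1..<n}. Poly_Mapping.single i (m - 1)) - \<Lambda>"

definition excludants :: "nat \<Rightarrow> nat \<Rightarrow> partition \<Rightarrow> nat list" where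
  "excludants m n \<Lambda> = sorted_list_of_set (Poly_Mapping.keys (complement m n \<Lambda>))"

text \<open>Past the end of the list \<open>e\<^sub>1 < \<dots> < e\<^sub>s\<close> the next excludant is taken to be \<open>n\<close>: the first
  positive integer that is not a part with full multiplicity once \<open>1, \<dots>, n-1\<close> are exhausted.
  In the first excludant condition this only matters for the full partition, where \<open>s = 0\<close>.
  It is needed there: for \<open>m = 4\<close>, \<open>n = 2\<close> the element \<open>x\<^sub>1\<^sup>3 \<partial>\<^sub>2\<close> belongs to the second
  term of the idealizer chain and not to the first, although its partition has no excludant
  at all.\<close>

definition excludant :: "nat \<Rightarrow> nat \<Rightarrow> partition \<Rightarrow> nat \<Rightarrow> nat" where
  "excludant m n \<Lambda> i =
     (if 1 \<le> i \<and> i \<le> length (excludants m n \<Lambda>) then excludants m n \<Lambda> ! (i - 1) else n)"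

text \<open>The \<open>i\<close>-th excludant condition for \<open>x\<^sup>\<Lambda> \<partial>\<^sub>k\<close>.\<close>

definition excludant_condition :: "nat \<Rightarrow> nat \<Rightarrow> nat \<Rightarrow> partition \<Rightarrow> nat \<Rightarrow> bool" where
  "excludant_condition m n i \<Lambda> k \<longleftrightarrow>
     1 \<le> i \<and> n < k + excludant m n \<Lambda> i \<and>
     (\<forall>i'. 1 \<le> i' \<and> i' < i \<longrightarrow> \<not> n < k + excludant m n \<Lambda> i')"

section \<open>The ring of truncated polynomials\<close>

text \<open>The coefficient ring \<open>\<int>\<^sub>m\<close> is \<open>'a mod_ring\<close>, where \<open>m = CARD('a)\<close>. An element of
  \<open>\<int>\<^sub>m[x\<^sub>1, x\<^sub>2, \<dots>] / (x\<^sub>1\<^sup>m, x\<^sub>2\<^sup>m, \<dots>)\<close> is represented by its unique representative in which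
  all exponents are less than \<open>m\<close>; the product of the quotient ring is the polynomial product
  followed by deletion of all monomials having some exponent \<open>\<ge> m\<close>.\<close>

type_synonym 'a trunc_poly = "partition \<Rightarrow>\<^sub>0 'a mod_ring"

definition monomial :: "partition \<Rightarrow> 'a::nontriv trunc_poly" where
  "monomial \<Lambda> = Poly_Mapping.single \<Lambda> 1"

definition trunc :: "'a::nontriv trunc_poly \<Rightarrow> 'a trunc_poly" where
  "trunc p = (\<Sum>\<Lambda> | \<Lambda> \<in> Poly_Mapping.keys p \<and> (\<forall>i. Poly_Mapping.lookup \<Lambda> i < CARD('a)).
                Poly_Mapping.single \<Lambda> (Poly_Mapping.lookup p \<Lambda>))"

definition trunc_mult :: "'a::nontriv trunc_poly \<Rightarrow> 'a trunc_poly \<Rightarrow> 'a trunc_poly"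
    (infixl \<open>\<odot>\<close> 70) where
  "p \<odot> q = trunc (p * q)"

text \<open>The partial derivative \<open>\<partial>\<^sub>k\<close>. It preserves the ideal \<open>(x\<^sub>1\<^sup>m, x\<^sub>2\<^sup>m, \<dots>)\<close>, as \<open>m = 0\<close> in the
  coefficient ring, so it may be computed on reduced representatives.\<close>

definition partial :: "nat \<Rightarrow> 'a::nontriv trunc_poly \<Rightarrow> 'a trunc_poly" where
  "partial k p = (\<Sum>\<Lambda>\<in>Poly_Mapping.keys p.
     Poly_Mapping.single (\<Lambda> - Poly_Mapping.single k 1)
       (of_nat (Poly_Mapping.lookup \<Lambda> k) * Poly_Mapping.lookup p \<Lambda>))"

section \<open>The Lie ring of partitions\<close>

text \<open>The pair \<open>(\<Lambda>, k)\<close> indexes the basis element \<open>x\<^sup>\<Lambda> \<partial>\<^sub>k\<close>. The Lie ring is the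
  \<open>\<int>\<^sub>m\<close>-submodule \<open>lie_ring n\<close>; the bracket is given by the same formula on all pairs.\<close>

type_synonym 'a lie = "(partition \<times> nat) \<Rightarrow>\<^sub>0 'a mod_ring"

definition xd :: "partition \<Rightarrow> nat \<Rightarrow> 'a::nontriv lie" where
  "xd \<Lambda> k = Poly_Mapping.single (\<Lambda>, k) 1"

definition smult :: "'a::nontriv mod_ring \<Rightarrow> 'a lie \<Rightarrow> 'a lie" where
  "smult c u = Poly_Mapping.map ((*) c) u"

definition basis :: "nat \<Rightarrow> 'a::nontriv lie set" where
  "basis n = {xd \<Lambda> k | \<Lambda> k. 1 \<le> k \<and> k \<le> n \<and> \<Lambda> \<in> partitions_upto (CARD('a)) (k - 1)}"

definition lie_ring :: "nat \<Rightarrow> 'a::nontriv lie set" where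
  "lie_ring n = {u. \<forall>(\<Lambda>, k) \<in> Poly_Mapping.keys u. xd \<Lambda> k \<in> (basis n :: 'a lie set)}"

text \<open>The element \<open>p \<partial>\<^sub>k\<close> for a truncated polynomial \<open>p\<close>.\<close>

definition poly_d :: "'a::nontriv trunc_poly \<Rightarrow> nat \<Rightarrow> 'a lie" where
  "poly_d p k = (\<Sum>\<Lambda>\<in>Poly_Mapping.keys p. smult (Poly_Mapping.lookup p \<Lambda>) (xd \<Lambda> k))"

definition bracket_basis :: "partition \<Rightarrow> nat \<Rightarrow> partition \<Rightarrow> nat \<Rightarrow> 'a::nontriv lie" where
  "bracket_basis \<Lambda> k \<Theta> j =
     poly_d (partial j (monomial \<Lambda>) \<odot> monomial \<Theta>) k
   - poly_d (monomial \<Lambda> \<odot> partial k (monomial \<Theta>)) j"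

definition bracket :: "'a::nontriv lie \<Rightarrow> 'a lie \<Rightarrow> 'a lie" where
  "bracket u v = (\<Sum>(\<Lambda>, k)\<in>Poly_Mapping.keys u. \<Sum>(\<Theta>, j)\<in>Poly_Mapping.keys v.
     smult (Poly_Mapping.lookup u (\<Lambda>, k) * Poly_Mapping.lookup v (\<Theta>, j))
       (bracket_basis \<Lambda> k \<Theta> j))"

lemma smult_one [simp]: "smult 1 u = u"
  by (intro poly_mapping_eqI) (simp add: smult_def Poly_Mapping.map.rep_eq when_def)

lemma bracket_xd: "bracket (xd \<Lambda> k) (xd \<Theta> j) = bracket_basis \<Lambda> k \<Theta> j"
  by (simp add: bracket_def xd_def)

section \<open>The idealizer chain\<close>

text \<open>The set \<open>\<int>\<^sub>m \<H>\<close> of scalar multiples (not the submodule spanned by \<open>\<H>\<close>).\<close>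

definition scalar_multiples :: "'a::nontriv lie set \<Rightarrow> 'a lie set" where
  "scalar_multiples H = {smult c h | c h. h \<in> H}"

definition basis_normalizer :: "nat \<Rightarrow> 'a::nontriv lie set \<Rightarrow> 'a lie set" where
  "basis_normalizer n H = {b \<in> basis n. \<forall>h\<in>H. bracket b h \<in> scalar_multiples H}"

primrec chain :: "nat \<Rightarrow> nat \<Rightarrow> 'a::nontriv lie set" where
  "chain n 0 = {xd 0 k | k. 1 \<le> k \<and> k \<le> n}"
| "chain n (Suc i) = basis_normalizer n (chain n i)"

text \<open>\<open>idealizer n i\<close> is \<open>\<N>\<^sub>i\<close>, for \<open>i \<ge> -1\<close>; \<open>chain\<close> is the same sequence indexed from \<open>0\<close>.\<close>

definition idealizer :: "nat \<Rightarrow> int \<Rightarrow> 'a::nontriv lie set" where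
  "idealizer n i = chain n (nat (i + 1))"

end

theory Submission
  imports Defs
begin

text \<open>
  The degree \<open>k - wt \<Lambda>\<close> of \<open>x\<^sup>\<Lambda> \<partial>\<^sub>k\<close> is additive under the bracket. Let \<open>\<delta> = 1\<close> if \<open>m = 2\<close> and
  \<open>\<delta> = 0\<close> otherwise. Up to \<open>i = n - 1 - \<delta>\<close> the term \<open>\<N>\<^sub>i\<close> consists of the elements \<open>\<partial>\<^sub>k\<close>, \<open>x\<^sub>j \<partial>\<^sub>k\<close>
  and those of degree at least \<open>n - 1 - \<delta> - i\<close>: an element of smaller degree is moved by
  one of the degree one elements \<open>\<partial>\<^sub>1\<close>, \<open>x\<^sub>j \<partial>\<^bsub>j+1\<^esub>\<close> to a nonzero element that is still too low, unless the
  result is linear, which only concerns \<open>x\<^sub>1\<^sup>2 \<partial>\<^sub>n\<close> and, for \<open>m = 2\<close>, \<open>x\<^sub>1 x\<^sub>2 \<partial>\<^sub>n\<close>.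

  Hence \<open>\<N>\<^bsub>n-1-\<delta>\<^esub>\<close> is the set of all elements of degree at least \<open>0\<close>, and by the same argument a new element
  \<open>x\<^sup>\<Lambda> \<partial>\<^sub>k\<close> of the next idealizer has degree \<open>-1\<close>. It must then annihilate every \<open>x\<^sup>\<Theta> \<partial>\<^sub>j\<close> with \<open>wt \<Theta> = j\<close>.
  For \<open>j < k\<close> a nonzero bracket is a refinement of the part \<open>j\<close> of \<open>\<Lambda>\<close>; for \<open>j > k\<close> it
  adds to \<open>\<Lambda>\<close> parts of total weight \<open>j - k \<le> n - k\<close>, which is impossible exactly when the first
  excludant exceeds \<open>n - k\<close>.
\<close>

section \<open>Weights and the bracket of basis elements\<close>

abbreviation part :: "nat \<Rightarrow> partition" where
  "part i \<equiv> Poly_Mapping.single i 1"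

lemma wt_superset:
  assumes "finite S" "Poly_Mapping.keys \<Lambda> \<subseteq> S"
  shows "wt \<Lambda> = (\<Sum>i\<in>S. i * Poly_Mapping.lookup \<Lambda> i)"
  unfolding wt_def using assms by (rule sum.mono_neutral_left) (simp add: in_keys_iff)

lemma wt_0 [simp]: "wt 0 = 0"
  by (simp add: wt_def)

lemma wt_single [simp]: "wt (Poly_Mapping.single i c) = i * c"
  by (cases "c = 0") (simp_all add: wt_def)

lemma wt_add: "wt (\<Lambda> + \<Theta>) = wt \<Lambda> + wt \<Theta>"
proof -
  let ?S = "Poly_Mapping.keys \<Lambda> \<union> Poly_Mapping.keys \<Theta>"
  have "wt (\<Lambda> + \<Theta>) = (\<Sum>i\<in>?S. i * Poly_Mapping.lookup (\<Lambda> + \<Theta>) i)"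
    by (rule wt_superset) (use keys_add[of \<Lambda> \<Theta>] in auto)
  also have "\<dots> = (\<Sum>i\<in>?S. i * Poly_Mapping.lookup \<Lambda> i) + (\<Sum>i\<in>?S. i * Poly_Mapping.lookup \<Theta> i)"
    by (simp add: lookup_add algebra_simps sum.distrib)
  also have "\<dots> = wt \<Lambda> + wt \<Theta>"
    by (simp add: wt_superset[of ?S \<Lambda>] wt_superset[of ?S \<Theta>])
  finally show ?thesis .
qed

lemma remove_part:
  assumes "1 \<le> Poly_Mapping.lookup \<Lambda> j"
  shows "\<Lambda> - part j + part j = \<Lambda>"
  using assms by (intro poly_mapping_eqI) (auto simp: lookup_add lookup_minus lookup_single when_def)

lemma wt_remove_part:
  assumes "1 \<le> Poly_Mapping.lookup \<Lambda> j"
  shows "wt (\<Lambda> - part j) + j = wt \<Lambda>"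
  using wt_add[of "\<Lambda> - part j" "part j"] remove_part[OF assms] by simp

lemma wt_shift:
  assumes "1 \<le> Poly_Mapping.lookup \<Lambda> (i + 1)"
  shows "wt (\<Lambda> - part (i + 1) + part i) + 1 = wt \<Lambda>"
  using wt_remove_part[OF assms] by (simp add: wt_add)

lemma lookup_mult_le_wt: "i * Poly_Mapping.lookup \<Lambda> i \<le> wt \<Lambda>"
proof (cases "i \<in> Poly_Mapping.keys \<Lambda>")
  case True
  then show ?thesis unfolding wt_def by (intro member_le_sum) auto
qed (simp add: in_keys_iff)

section \<open>Basis elements and the explicit form of their brackets\<close>

lemma xd_inj [simp]: "(xd \<Lambda> k :: 'a::nontriv lie) = xd \<Theta> j \<longleftrightarrow> \<Lambda> = \<Theta> \<and> k = j"
  by (metis lookup_single_eq lookup_single_not_eq one_neq_zero prod.inject xd_def)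

lemma xd_basis_iff:
  "(xd \<Lambda> k :: 'a::nontriv lie) \<in> basis n \<longleftrightarrow>
     1 \<le> k \<and> k \<le> n \<and> Poly_Mapping.keys \<Lambda> \<subseteq> {1..<k} \<and> (\<forall>i. Poly_Mapping.lookup \<Lambda> i < CARD('a))"
proof -
  have "x \<le> CARD('a) - 1 \<longleftrightarrow> x < CARD('a)" for x
    using nontriv[where 'a='a] by auto
  moreover have "{1..k - 1} = {1..<k}" if "1 \<le> k" using that by auto
  ultimately show ?thesis by (auto simp: basis_def partitions_upto_def)
qed

text \<open>The ring has characteristic m, so a nonzero exponent of a reduced monomial stays nonzero
  as a coefficient. For composite m it may be a zero divisor, but only its vanishing matters
  below.\<close>

lemma of_nat_mod_ring_eq_0_iff:
  assumes "x < CARD('a::nontriv)"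
  shows "(of_nat x :: 'a mod_ring) = 0 \<longleftrightarrow> x = 0"
  using assms by (auto simp: of_nat_eq_0_iff_char_dvd dest: nat_dvd_not_less)

lemma trunc_single:
  "trunc (Poly_Mapping.single \<Lambda> c :: 'a::nontriv trunc_poly) =
     (if \<forall>i. Poly_Mapping.lookup \<Lambda> i < CARD('a) then Poly_Mapping.single \<Lambda> c else 0)"
proof (cases "c = 0")
  case False
  then have "{\<Theta> \<in> Poly_Mapping.keys (Poly_Mapping.single \<Lambda> c :: 'a trunc_poly). \<forall>i. Poly_Mapping.lookup \<Theta> i < CARD('a)}
      = (if \<forall>i. Poly_Mapping.lookup \<Lambda> i < CARD('a) then {\<Lambda>} else {})" by auto
  then show ?thesis by (simp add: trunc_def)
qed (simp add: trunc_def)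

lemma partial_monomial:
  "partial k (monomial \<Lambda> :: 'a::nontriv trunc_poly) =
     Poly_Mapping.single (\<Lambda> - part k) (of_nat (Poly_Mapping.lookup \<Lambda> k))"
  by (simp add: partial_def monomial_def)

lemma smult_xd: "smult c (xd \<Lambda> k) = Poly_Mapping.single (\<Lambda>, k) (c :: 'a::nontriv mod_ring)"
  by (intro poly_mapping_eqI) (simp add: smult_def xd_def Poly_Mapping.map.rep_eq when_def lookup_single)

lemma poly_d_single:
  "poly_d (Poly_Mapping.single \<Lambda> c :: 'a::nontriv trunc_poly) k = Poly_Mapping.single (\<Lambda>, k) c"
  by (cases "c = 0") (simp_all add: poly_d_def smult_xd)

text \<open>Each term is a product of monomials, hence a multiple of one basis element or cut off by
  truncation. If j is not a part of \<Lambda>, then \<open>\<Lambda> - part j\<close> is no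
  derivative, but its coefficient is 0.\<close>

lemma bracket_basis_eq:
  "(bracket_basis \<Lambda> k \<Theta> j :: 'a::nontriv lie) =
     (if \<forall>i. Poly_Mapping.lookup (\<Lambda> - part j + \<Theta>) i < CARD('a)
      then Poly_Mapping.single (\<Lambda> - part j + \<Theta>, k) (of_nat (Poly_Mapping.lookup \<Lambda> j)) else 0)
   - (if \<forall>i. Poly_Mapping.lookup (\<Lambda> + (\<Theta> - part k)) i < CARD('a)
      then Poly_Mapping.single (\<Lambda> + (\<Theta> - part k), j) (of_nat (Poly_Mapping.lookup \<Theta> k)) else 0)"
proof -
  have "poly_d 0 l = (0 :: 'a lie)" for l by (simp add: poly_d_def)
  then show ?thesis
    unfolding bracket_basis_def partial_monomial
    by (simp add: trunc_mult_def trunc_single monomial_def mult_single poly_d_single)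
qed

section \<open>Normalizers of sets of basis elements as combinatorial conditions\<close>

lemma single_in_scalar_multiples_iff:
  assumes "H \<subseteq> basis n" "H \<noteq> {}"
  shows "Poly_Mapping.single (\<Lambda>, k) (c :: 'a::nontriv mod_ring) \<in> scalar_multiples H \<longleftrightarrow>
     c = 0 \<or> xd \<Lambda> k \<in> H"
proof
  assume "Poly_Mapping.single (\<Lambda>, k) c \<in> scalar_multiples H"
  then obtain d h where h: "h \<in> H" "Poly_Mapping.single (\<Lambda>, k) c = smult d h"
    by (auto simp: scalar_multiples_def)
  with assms obtain \<Theta> j where h': "h = xd \<Theta> j" by (auto simp: basis_def)
  have "Poly_Mapping.single (\<Lambda>, k) c = Poly_Mapping.single (\<Theta>, j) d"
    using h h' by (simp add: smult_xd)
  then have "c = 0 \<or> (\<Lambda>, k) = (\<Theta>, j)"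
    by (metis lookup_single_eq lookup_single_not_eq)
  then show "c = 0 \<or> xd \<Lambda> k \<in> H" using h h' by auto
next
  assume "c = 0 \<or> xd \<Lambda> k \<in> H"
  then show "Poly_Mapping.single (\<Lambda>, k) c \<in> scalar_multiples H"
  proof
    assume c: "c = 0"
    obtain h where h: "h \<in> H" using assms by auto
    then obtain \<Theta> j where "h = xd \<Theta> j" using assms by (auto simp: basis_def)
    then have "smult 0 h = Poly_Mapping.single (\<Lambda>, k) c" by (simp add: smult_xd c)
    with h show ?thesis unfolding scalar_multiples_def by (metis (mono_tags, lifting) mem_Collect_eq)
  next
    assume "xd \<Lambda> k \<in> H"
    then show ?thesis unfolding scalar_multiples_def using smult_xd[of c \<Lambda> k] by (metis (mono_tags, lifting) mem_Collect_eq)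
  qed
qed

lemma uminus_in_scalar_multiples_iff:
  "- u \<in> scalar_multiples H \<longleftrightarrow> u \<in> scalar_multiples (H :: 'a::nontriv lie set)"
proof -
  have "- smult c h = smult (- c) h" for c and h :: "'a lie"
    by (intro poly_mapping_eqI) (simp add: smult_def Poly_Mapping.map.rep_eq when_def)
  then have "- v \<in> scalar_multiples H" if "v \<in> scalar_multiples H" for v
    using that by (force simp: scalar_multiples_def)
  from this[of u] this[of "- u"] show ?thesis by auto
qed

text \<open>By triangularity at most one term of the bracket survives: j a part of \<Lambda> forces
  j < k, and k a part of \<Theta> forces k < j. So signs and nonzero coefficients do not matter.
  Both conditions have the same shape with the roles exchanged, so one argument can serve for
  both.\<close>

lemma bracket_in_scalar_multiples_iff:
  assumes "H \<subseteq> (basis n :: 'a::nontriv lie set)" "xd \<Lambda> k \<in> (basis n :: 'a lie set)" "xd \<Theta> j \<in> H"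
  shows "bracket (xd \<Lambda> k) (xd \<Theta> j) \<in> scalar_multiples H \<longleftrightarrow>
     (1 \<le> Poly_Mapping.lookup \<Lambda> j \<longrightarrow> (\<forall>i. Poly_Mapping.lookup (\<Lambda> - part j + \<Theta>) i < CARD('a)) \<longrightarrow>
        xd (\<Lambda> - part j + \<Theta>) k \<in> H) \<and>
     (1 \<le> Poly_Mapping.lookup \<Theta> k \<longrightarrow> (\<forall>i. Poly_Mapping.lookup (\<Theta> - part k + \<Lambda>) i < CARD('a)) \<longrightarrow>
        xd (\<Theta> - part k + \<Lambda>) j \<in> H)"
proof -
  have H: "H \<noteq> {}" using assms by auto
  have zero: "0 \<in> scalar_multiples H"
    using single_in_scalar_multiples_iff[OF assms(1) H, of \<Lambda> k 0] by simp
  have \<Lambda>: "Poly_Mapping.keys \<Lambda> \<subseteq> {1..<k}" "\<And>i. Poly_Mapping.lookup \<Lambda> i < CARD('a)"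
    and \<Theta>: "Poly_Mapping.keys \<Theta> \<subseteq> {1..<j}" "\<And>i. Poly_Mapping.lookup \<Theta> i < CARD('a)"
    using assms by (auto simp: xd_basis_iff dest!: subsetD)
  note eq0 = of_nat_mod_ring_eq_0_iff[where 'a='a]
  note iff = single_in_scalar_multiples_iff[OF assms(1) H]
  have "Poly_Mapping.lookup \<Lambda> j = 0 \<or> Poly_Mapping.lookup \<Theta> k = 0"
    using \<Lambda>(1) \<Theta>(1) by (metis atLeastLessThan_iff in_keys_iff less_asym subsetD)
  then show ?thesis
  proof
    assume j: "Poly_Mapping.lookup \<Lambda> j = 0"
    have "bracket (xd \<Lambda> k) (xd \<Theta> j) = - (if \<forall>i. Poly_Mapping.lookup (\<Theta> - part k + \<Lambda>) i < CARD('a)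
        then Poly_Mapping.single (\<Theta> - part k + \<Lambda>, j) (of_nat (Poly_Mapping.lookup \<Theta> k)) else (0 :: 'a lie))"
      by (simp add: bracket_xd bracket_basis_eq j add.commute)
    then show ?thesis
      using eq0[OF \<Theta>(2)[of k]] by (cases "Poly_Mapping.lookup \<Theta> k = 0") (auto simp: uminus_in_scalar_multiples_iff iff zero j Suc_le_eq)
  next
    assume k: "Poly_Mapping.lookup \<Theta> k = 0"
    have "bracket (xd \<Lambda> k) (xd \<Theta> j) = (if \<forall>i. Poly_Mapping.lookup (\<Lambda> - part j + \<Theta>) i < CARD('a)
        then Poly_Mapping.single (\<Lambda> - part j + \<Theta>, k) (of_nat (Poly_Mapping.lookup \<Lambda> j)) else (0 :: 'a lie))"
      by (simp add: bracket_xd bracket_basis_eq k)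
    then show ?thesis
      using eq0[OF \<Lambda>(2)[of j]] by (cases "Poly_Mapping.lookup \<Lambda> j = 0") (auto simp: iff zero k Suc_le_eq)
  qed
qed

lemma xd_bracket_in_basis:
  assumes "xd \<Lambda> k \<in> (basis n :: 'a::nontriv lie set)" "xd \<Theta> j \<in> (basis n :: 'a lie set)"
    and "1 \<le> Poly_Mapping.lookup \<Lambda> j" "\<forall>i. Poly_Mapping.lookup (\<Lambda> - part j + \<Theta>) i < CARD('a)"
  shows "xd (\<Lambda> - part j + \<Theta>) k \<in> (basis n :: 'a lie set)"
proof -
  have k: "1 \<le> k" "k \<le> n" "Poly_Mapping.keys \<Lambda> \<subseteq> {1..<k}" and \<Theta>: "Poly_Mapping.keys \<Theta> \<subseteq> {1..<j}"
    using assms(1,2) unfolding xd_basis_iff by blast+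
  have "j \<in> Poly_Mapping.keys \<Lambda>" using assms(3) by (simp add: in_keys_iff)
  then have "j < k" using k(3) by auto
  have "Poly_Mapping.keys (\<Lambda> - part j + \<Theta>) \<subseteq> Poly_Mapping.keys \<Lambda> \<union> Poly_Mapping.keys \<Theta>"
    by (auto simp: in_keys_iff lookup_add lookup_minus)
  also have "\<dots> \<subseteq> {1..<k}" using k(3) \<Theta> \<open>j < k\<close> by fastforce
  finally show ?thesis using k(1,2) assms(4) unfolding xd_basis_iff by blast
qed

lemma xd_in_basis_normalizer_iff:
  assumes "H \<subseteq> (basis n :: 'a::nontriv lie set)"
  shows "xd \<Lambda> k \<in> basis_normalizer n H \<longleftrightarrow> xd \<Lambda> k \<in> (basis n :: 'a lie set) \<and>
     (\<forall>\<Theta> j. xd \<Theta> j \<in> H \<longrightarrow>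
       (1 \<le> Poly_Mapping.lookup \<Lambda> j \<longrightarrow>
          (\<forall>i. Poly_Mapping.lookup (\<Lambda> - part j + \<Theta>) i < CARD('a)) \<longrightarrow>
          xd (\<Lambda> - part j + \<Theta>) k \<in> H) \<and>
       (1 \<le> Poly_Mapping.lookup \<Theta> k \<longrightarrow>
          (\<forall>i. Poly_Mapping.lookup (\<Theta> - part k + \<Lambda>) i < CARD('a)) \<longrightarrow>
          xd (\<Theta> - part k + \<Lambda>) j \<in> H))"
    (is "_ \<longleftrightarrow> _ \<and> (\<forall>\<Theta> j. _ \<longrightarrow> ?P \<Theta> j)")
proof (cases "xd \<Lambda> k \<in> (basis n :: 'a lie set)")
  case True
  have "xd \<Lambda> k \<in> basis_normalizer n H \<longleftrightarrow>
      (\<forall>\<Theta> j. xd \<Theta> j \<in> H \<longrightarrow> bracket (xd \<Lambda> k) (xd \<Theta> j) \<in> scalar_multiples H)"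
  proof -
    have "\<exists>\<Theta> j. h = xd \<Theta> j" if "h \<in> H" for h
      using that assms by (auto simp: basis_def)
    then show ?thesis using True unfolding basis_normalizer_def by blast
  qed
  also have "\<dots> \<longleftrightarrow> (\<forall>\<Theta> j. xd \<Theta> j \<in> H \<longrightarrow> ?P \<Theta> j)"
    using bracket_in_scalar_multiples_iff[OF assms True] by blast
  finally show ?thesis using True by blast
qed (simp add: basis_normalizer_def)

lemma basis_normalizer_subset: "basis_normalizer n H \<subseteq> basis n"
  by (auto simp: basis_normalizer_def)

lemma basis_normalizerD:
  assumes "xd \<Lambda> k \<in> basis_normalizer n H" "H \<subseteq> (basis n :: 'a::nontriv lie set)" "xd \<Theta> j \<in> H"
  shows "1 \<le> Poly_Mapping.lookup \<Lambda> j \<Longrightarrow>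
      (\<And>i. Poly_Mapping.lookup (\<Lambda> - part j + \<Theta>) i < CARD('a)) \<Longrightarrow> xd (\<Lambda> - part j + \<Theta>) k \<in> H"
    and "1 \<le> Poly_Mapping.lookup \<Theta> k \<Longrightarrow>
      (\<And>i. Poly_Mapping.lookup (\<Theta> - part k + \<Lambda>) i < CARD('a)) \<Longrightarrow> xd (\<Theta> - part k + \<Lambda>) j \<in> H"
  using assms xd_in_basis_normalizer_iff[OF assms(2), of \<Lambda> k] by blast+

section \<open>The idealizer chain in nonnegative degree\<close>

definition affine :: "partition \<Rightarrow> bool" where
  "affine \<Lambda> \<longleftrightarrow> \<Lambda> = 0 \<or> (\<exists>j. \<Lambda> = part j)"

text \<open>The affine elements form the term N_0 and remain in all later terms; t bounds the degree
  of the others.\<close>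

definition level :: "nat \<Rightarrow> nat \<Rightarrow> 'a::nontriv lie set" where
  "level n t = {xd \<Lambda> k | \<Lambda> k. xd \<Lambda> k \<in> (basis n :: 'a lie set) \<and> (affine \<Lambda> \<or> wt \<Lambda> + t \<le> k)}"

lemma xd_in_level_iff:
  "(xd \<Lambda> k :: 'a::nontriv lie) \<in> level n t \<longleftrightarrow>
     (xd \<Lambda> k :: 'a lie) \<in> basis n \<and> (affine \<Lambda> \<or> wt \<Lambda> + t \<le> k)"
  by (auto simp: level_def)

lemma level_subset: "level n t \<subseteq> basis n"
  by (auto simp: level_def)

lemma affine_0 [simp]: "affine 0" and affine_part: "affine (part j)"
  unfolding affine_def by blast+

lemma part_in_level:
  assumes "1 \<le> i" "i < j" "j \<le> n"
  shows "xd (part i) j \<in> (level n t :: 'a::nontriv lie set)"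
proof -
  have "Poly_Mapping.lookup (part i) l < CARD('a)" for l
    using nontriv[where 'a='a] by (simp add: lookup_single when_def)
  then show ?thesis using assms affine_part[of i] by (simp add: xd_in_level_iff xd_basis_iff)
qed

lemma affine_remove_part:
  assumes "affine \<Lambda>" "1 \<le> Poly_Mapping.lookup \<Lambda> j"
  shows "\<Lambda> = part j"
  using assms by (auto simp: affine_def lookup_single when_def split: if_splits)

lemma affine_add_part:
  assumes "affine (\<Lambda> + part i)"
  shows "\<Lambda> = 0"
  using affine_remove_part[OF assms, of i] by (simp add: lookup_add)

lemma affine_wt_less:
  assumes "affine \<Lambda>" "(xd \<Lambda> k :: 'a::nontriv lie) \<in> basis n"
  shows "wt \<Lambda> < k"
  using assms by (auto simp: affine_def xd_basis_iff)

lemma eq_0_if_wt_less: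
  assumes "Poly_Mapping.keys \<Lambda> \<subseteq> {r..}" "wt \<Lambda> < r"
  shows "\<Lambda> = 0"
proof (rule ccontr)
  assume "\<Lambda> \<noteq> 0"
  then obtain i where i: "i \<in> Poly_Mapping.keys \<Lambda>" by (metis all_not_in_conv keys_eq_empty)
  then have "r * 1 \<le> i * Poly_Mapping.lookup \<Lambda> i"
    using assms(1) i by (intro mult_le_mono) (auto simp: Suc_le_eq in_keys_iff subset_iff)
  also have "\<dots> \<le> wt \<Lambda>" by (rule lookup_mult_le_wt)
  finally show False using assms(2) by simp
qed

text \<open>Degrees add. An affine \<Lambda> equals \<open>part j\<close>, and the bracket keeps
  \<Theta> while raising its degree by k - j >= 1; an affine \<Theta> has degree at least 1 itself.
  These cases account for the bounds with \<open>+ 1\<close>, two nonaffine factors for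
  \<open>s + t\<close>.\<close>

lemma bracket_in_level:
  assumes "xd \<Lambda> k \<in> (level n s :: 'a::nontriv lie set)" "xd \<Theta> j \<in> (level n t :: 'a lie set)"
    and "1 \<le> Poly_Mapping.lookup \<Lambda> j"
    and "\<forall>i. Poly_Mapping.lookup (\<Lambda> - part j + \<Theta>) i < CARD('a)"
    and "u \<le> s + 1" "u \<le> t + 1" "u \<le> s + t"
  shows "xd (\<Lambda> - part j + \<Theta>) k \<in> (level n u :: 'a lie set)"
proof -
  have basis: "xd \<Lambda> k \<in> (basis n :: 'a lie set)" "xd \<Theta> j \<in> (basis n :: 'a lie set)"
    using assms by (auto simp: xd_in_level_iff)
  have wt: "wt (\<Lambda> - part j + \<Theta>) + j = wt \<Lambda> + wt \<Theta>"
    using wt_remove_part[OF assms(3)] by (simp add: wt_add)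
  have "affine (\<Lambda> - part j + \<Theta>) \<or> wt (\<Lambda> - part j + \<Theta>) + u \<le> k"
  proof (cases "affine \<Lambda>")
    case True
    then have "\<Lambda> - part j + \<Theta> = \<Theta>" using affine_remove_part[OF _ assms(3)] by auto
    then show ?thesis
      using True wt affine_wt_less[OF True basis(1)] assms by (auto simp: xd_in_level_iff)
  next
    case False
    then have "wt \<Lambda> + s \<le> k" using assms by (simp add: xd_in_level_iff)
    moreover have "wt \<Theta> + 1 \<le> j \<or> wt \<Theta> + t \<le> j"
      using assms(2) affine_wt_less[OF _ basis(2)] by (auto simp: xd_in_level_iff)
    ultimately show ?thesis using wt assms(5-7) by linarith
  qed
  then show ?thesis using xd_bracket_in_basis[OF basis assms(3,4)] by (simp add: xd_in_level_iff)
qed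

text \<open>For t >= 1, degrees t - 1 and t add up to 2t - 1 >= t. At t = 0 the subtraction
  truncates, and the claim is that \<open>level n 0\<close> normalizes itself.\<close>

lemma level_subset_basis_normalizer:
  "level n (t - 1) \<subseteq> basis_normalizer n (level n t :: 'a::nontriv lie set)"
proof
  fix b :: "'a lie"
  assume b: "b \<in> level n (t - 1)"
  then obtain \<Lambda> k where b_eq: "b = xd \<Lambda> k" by (auto simp: level_def)
  have "xd \<Lambda> k \<in> basis_normalizer n (level n t :: 'a lie set)"
    unfolding xd_in_basis_normalizer_iff[OF level_subset]
  proof (intro conjI allI impI)
    show "xd \<Lambda> k \<in> (basis n :: 'a lie set)" using b level_subset b_eq by blast
  next
    fix \<Theta> j
    assume \<Theta>: "xd \<Theta> j \<in> (level n t :: 'a lie set)"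
    show "xd (\<Lambda> - part j + \<Theta>) k \<in> (level n t :: 'a lie set)"
      if "1 \<le> Poly_Mapping.lookup \<Lambda> j"
        "\<forall>i. Poly_Mapping.lookup (\<Lambda> - part j + \<Theta>) i < CARD('a)"
      using that b by (intro bracket_in_level[OF _ \<Theta>, where s = "t - 1"]) (auto simp: b_eq)
    show "xd (\<Theta> - part k + \<Lambda>) j \<in> (level n t :: 'a lie set)"
      if "1 \<le> Poly_Mapping.lookup \<Theta> k"
        "\<forall>i. Poly_Mapping.lookup (\<Theta> - part k + \<Lambda>) i < CARD('a)"
      using that b by (intro bracket_in_level[OF \<Theta>, where t = "t - 1"]) (auto simp: b_eq)
  qed
  then show "b \<in> basis_normalizer n (level n t)" by (simp add: b_eq)
qed

section \<open>Degree bounds for normalizing elements, tested on elements of degree one\<close>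

context
  fixes \<Lambda> :: partition and n k t :: nat
  assumes norm: "xd \<Lambda> k \<in> basis_normalizer n (level n t :: 'a::nontriv lie set)"
begin

lemma normalizer_basis: "xd \<Lambda> k \<in> (basis n :: 'a lie set)"
  using norm basis_normalizer_subset by blast

lemma normalizer_raise:
  assumes "k < n"
  shows "xd \<Lambda> (k + 1) \<in> (level n t :: 'a lie set)"
proof -
  have "xd (part k) (k + 1) \<in> (level n t :: 'a lie set)"
    using assms normalizer_basis by (intro part_in_level) (simp_all add: xd_basis_iff)
  then show ?thesis
    using basis_normalizerD(2)[OF norm level_subset, of "part k" "k + 1"] normalizer_basis
    by (simp add: xd_basis_iff)
qed

lemma normalizer_drop:
  assumes "1 \<le> Poly_Mapping.lookup \<Lambda> 1"
  shows "xd (\<Lambda> - part 1) k \<in> (level n t :: 'a lie set)"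
proof -
  have "xd 0 1 \<in> (level n t :: 'a lie set)"
    using normalizer_basis by (simp add: xd_in_level_iff xd_basis_iff)
  then show ?thesis
    using basis_normalizerD(1)[OF norm level_subset, of 0 1] normalizer_basis assms
    by (simp add: xd_basis_iff lookup_minus less_imp_diff_less)
qed

text \<open>The bracket with x_i d_(i+1) trades a part i + 1 for a part i; the last assumption keeps
  the result from being truncated.\<close>

lemma normalizer_shift:
  assumes "1 \<le> i" "1 \<le> Poly_Mapping.lookup \<Lambda> (i + 1)" "Poly_Mapping.lookup \<Lambda> i + 1 < CARD('a)"
  shows "xd (\<Lambda> - part (i + 1) + part i) k \<in> (level n t :: 'a lie set)"
proof -
  have "i + 1 \<in> Poly_Mapping.keys \<Lambda>" using assms(2) by (simp add: in_keys_iff)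
  then have "i + 1 < k" "k \<le> n" using normalizer_basis by (auto simp: xd_basis_iff)
  then have "xd (part i) (i + 1) \<in> (level n t :: 'a lie set)"
    using assms(1) by (intro part_in_level) simp_all
  moreover have "Poly_Mapping.lookup (\<Lambda> - part (i + 1) + part i) l < CARD('a)" for l
  proof -
    have "Poly_Mapping.lookup \<Lambda> l < CARD('a)" using normalizer_basis by (simp add: xd_basis_iff)
    then show ?thesis using assms(3) by (auto simp: lookup_add lookup_minus lookup_single when_def)
  qed
  ultimately show ?thesis
    using basis_normalizerD(1)[OF norm level_subset _ assms(2)] by blast
qed

text \<open>Below the least part i + 1 all multiplicities are 0, so a part i fits for every m >=
  2.\<close>

lemma normalizer_shift_least:
  assumes "\<Lambda> \<noteq> 0" "Poly_Mapping.lookup \<Lambda> 1 = 0"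
  obtains i where "1 \<le> Poly_Mapping.lookup \<Lambda> (i + 1)"
    "xd (\<Lambda> - part (i + 1) + part i) k \<in> (level n t :: 'a lie set)"
proof -
  define j where "j = (LEAST j. j \<in> Poly_Mapping.keys \<Lambda>)"
  have j: "j \<in> Poly_Mapping.keys \<Lambda>"
    unfolding j_def using assms(1) by (metis LeastI all_not_in_conv keys_eq_empty)
  have least: "Poly_Mapping.lookup \<Lambda> i = 0" if "i < j" for i
    using not_less_Least[OF that[unfolded j_def]] by (simp add: in_keys_iff)
  have "1 \<le> j" using j normalizer_basis by (auto simp: xd_basis_iff)
  moreover have "j \<noteq> 1" using j assms(2) by (auto simp: in_keys_iff)
  ultimately obtain i where i: "j = i + 1" "1 \<le> i"
    by (intro that[of "j - 1"]) simp_all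
  show ?thesis
  proof (rule that)
    show *: "1 \<le> Poly_Mapping.lookup \<Lambda> (i + 1)" using j i by (simp add: in_keys_iff)
    show "xd (\<Lambda> - part (i + 1) + part i) k \<in> (level n t :: 'a lie set)"
      using normalizer_shift[OF i(2) *] least[of i] i(1) nontriv[where 'a='a] by simp
  qed
qed

text \<open>Raising k, dropping a part 1 or shifting the least part each adds one to the degree and
  lands in the level, which gives the bound unless the result is affine. Of these moves only the
  drop can turn a nonaffine element into an affine one.\<close>

lemma normalizer_wt_bound:
  assumes "\<not> affine \<Lambda>" "t + 1 + of_bool (CARD('a) = 2) \<le> n"
  shows "wt \<Lambda> + t \<le> k + 1"
proof -
  consider "k < n" | "k = n" "1 \<le> Poly_Mapping.lookup \<Lambda> 1" | "k = n" "Poly_Mapping.lookup \<Lambda> 1 = 0"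
    using normalizer_basis by (force simp: xd_basis_iff)
  then show ?thesis
  proof cases
    case 1
    then show ?thesis using normalizer_raise assms(1) by (simp add: xd_in_level_iff)
  next
    case 2
    note split = remove_part[OF 2(2)] and wt = wt_remove_part[OF 2(2)]
    from normalizer_drop[OF 2(2)] consider "wt (\<Lambda> - part 1) + t \<le> k" | "affine (\<Lambda> - part 1)"
      by (auto simp: xd_in_level_iff)
    then show ?thesis
    proof cases
      \<comment> \<open>The drop is affine, so the element is x_1 x_i d_n, and the bound must come
        from the size of i or from shifting i.\<close>
      case affine: 2
      have "\<Lambda> - part 1 \<noteq> 0" using split assms(1) by (metis add_0 affine_def)
      with affine obtain i where i: "\<Lambda> - part 1 = part i" by (auto simp: affine_def)
      then have \<Lambda>: "\<Lambda> = part i + part 1" using split by simp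
      then have "i \<in> Poly_Mapping.keys \<Lambda>" by (simp add: in_keys_iff lookup_add)
      then have "1 \<le> i" using normalizer_basis by (auto simp: xd_basis_iff)
      have wt_\<Lambda>: "wt \<Lambda> = i + 1" by (simp add: \<Lambda> wt_add)
      show ?thesis
      proof (cases "i \<le> 1 + of_bool (CARD('a) = 2)")
        \<comment> \<open>As k = n, the claim amounts to i + t <= n, which the assumed lower bound
          on n supplies for such small i.\<close>
        case True
        then show ?thesis using wt_\<Lambda> 2(1) assms(2) by simp
      next
        case False
        \<comment> \<open>Shift i to i - 1. This part already occurs only if i = 2; then its
          multiplicity is 1 and m >= 3 leaves room, since m = 2 gives i >= 3 here.\<close>
        define r where "r = i - 1"
        have r: "i = r + 1" "1 \<le> r" using False by (auto simp: r_def)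
        have r1: "1 \<le> Poly_Mapping.lookup \<Lambda> (r + 1)" by (simp add: \<Lambda> r lookup_add)
        have "Poly_Mapping.lookup \<Lambda> r + 1 < CARD('a)"
          using False r nontriv[where 'a='a]
          by (cases "CARD('a) = 2") (auto simp: \<Lambda> lookup_add lookup_single when_def)
        from normalizer_shift[OF r(2) r1 this]
        have "affine (\<Lambda> - part (r + 1) + part r) \<or> wt (\<Lambda> - part (r + 1) + part r) + t \<le> k"
          by (simp add: xd_in_level_iff)
        moreover have "\<Lambda> - part (r + 1) = part 1" by (simp add: \<Lambda> r)
        then have "\<not> affine (\<Lambda> - part (r + 1) + part r)"
          using affine_add_part by (metis keys_single keys_zero insert_not_empty one_neq_zero)
        ultimately show ?thesis using wt_shift[OF r1] by simp
      qed
    qed (use wt in simp)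
  next
    case 3
    have "\<Lambda> \<noteq> 0" using assms(1) by (auto simp: affine_def)
    from this 3(2) obtain i where i: "1 \<le> Poly_Mapping.lookup \<Lambda> (i + 1)"
      "xd (\<Lambda> - part (i + 1) + part i) k \<in> (level n t :: 'a lie set)" by (rule normalizer_shift_least)
    have "\<Lambda> - part (i + 1) \<noteq> 0"
      using remove_part[OF i(1)] assms(1) by (metis add_0 affine_def)
    then have "\<not> affine (\<Lambda> - part (i + 1) + part i)" using affine_add_part by blast
    then show ?thesis using i(2) wt_shift[OF i(1)] by (simp add: xd_in_level_iff)
  qed
qed

end

lemma basis_normalizer_level:
  assumes "1 \<le> t" "t + 1 + of_bool (CARD('a) = 2) \<le> n"
  shows "basis_normalizer n (level n t :: 'a::nontriv lie set) = level n (t - 1)"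
proof
  show "basis_normalizer n (level n t) \<subseteq> (level n (t - 1) :: 'a lie set)"
  proof
    fix b :: "'a lie"
    assume b: "b \<in> basis_normalizer n (level n t)"
    then have "b \<in> basis n" using basis_normalizer_subset by blast
    then obtain \<Lambda> k where b_eq: "b = xd \<Lambda> k" by (auto simp: basis_def)
    show "b \<in> level n (t - 1)"
      using normalizer_wt_bound[of \<Lambda> k n t, where 'a='a] \<open>b \<in> basis n\<close> b assms
      by (cases "affine \<Lambda>") (auto simp: b_eq xd_in_level_iff)
  qed
qed (rule level_subset_basis_normalizer)

text \<open>The origin of the Kronecker delta: the only nonaffine monomial of weight at most 2 is
  x_1^2, which is not reduced for m = 2.\<close>

lemma affine_if_wt_small:
  assumes "xd \<Lambda> k \<in> (basis n :: 'a::nontriv lie set)" "wt \<Lambda> \<le> 1 + of_bool (CARD('a) = 2)"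
  shows "affine \<Lambda>"
proof (cases "\<Lambda> = 0")
  case False
  then obtain j where j: "j \<in> Poly_Mapping.keys \<Lambda>" by (metis all_not_in_conv keys_eq_empty)
  let ?\<Lambda> = "\<Lambda> - part j"
  have j1: "1 \<le> j" "1 \<le> Poly_Mapping.lookup \<Lambda> j"
    using j assms(1) by (auto simp: xd_basis_iff in_keys_iff subset_iff)
  note wt = wt_remove_part[OF j1(2)]
  have keys: "Poly_Mapping.keys ?\<Lambda> \<subseteq> {1..}"
  proof
    fix i assume "i \<in> Poly_Mapping.keys ?\<Lambda>"
    then have "i \<in> Poly_Mapping.keys \<Lambda>" by (auto simp: in_keys_iff lookup_minus)
    then show "i \<in> {1..}" using assms(1) by (auto simp: xd_basis_iff)
  qed
  have "?\<Lambda> = 0"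
  proof (cases "wt ?\<Lambda> = 0")
    case True
    then show ?thesis using eq_0_if_wt_less[OF keys] by simp
  next
    case False
    then have 2: "CARD('a) = 2" "j = 1" "wt ?\<Lambda> = 1"
      using wt assms(2) j1(1) by (auto split: if_splits simp: of_bool_def)
    have "Poly_Mapping.lookup \<Lambda> 1 < 2" using assms(1) 2(1) by (auto simp: xd_basis_iff)
    then have "1 \<notin> Poly_Mapping.keys ?\<Lambda>" using 2(2) by (simp add: in_keys_iff lookup_minus)
    have "Poly_Mapping.keys ?\<Lambda> \<subseteq> {2..}"
    proof
      fix i assume i: "i \<in> Poly_Mapping.keys ?\<Lambda>"
      then have "1 \<le> i" using keys by auto
      moreover have "i \<noteq> 1" using i \<open>1 \<notin> Poly_Mapping.keys ?\<Lambda>\<close> by blast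
      ultimately show "i \<in> {2..}" by simp
    qed
    then show ?thesis using eq_0_if_wt_less[of ?\<Lambda> 2] 2(3) by simp
  qed
  then show ?thesis using remove_part[OF j1(2)] by (metis add_0 affine_def)
qed (simp add: affine_def)

section \<open>The idealizer chain down to degree zero\<close>

lemma chain_subset: "chain n i \<subseteq> (basis n :: 'a::nontriv lie set)"
proof (cases i)
  case 0
  have "xd 0 k \<in> (basis n :: 'a lie set)" if "1 \<le> k" "k \<le> n" for k
    using that by (simp add: xd_basis_iff)
  then show ?thesis using 0 by auto
qed (simp add: basis_normalizer_subset)

lemma xd_in_chain_0_iff: "(xd \<Lambda> k :: 'a::nontriv lie) \<in> chain n 0 \<longleftrightarrow> \<Lambda> = 0 \<and> 1 \<le> k \<and> k \<le> n"
  by auto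

text \<open>Brackets with each d_j must be multiples of d_k, which singles out the affine elements.
  Nonaffine ones have weight at least 2 + delta, hence degree at most n - 2 - delta, so the level on
  the right is affine too.\<close>

lemma chain_1:
  assumes "1 + of_bool (CARD('a) = 2) \<le> n"
  shows "chain n 1 = (level n (n - 1 - of_bool (CARD('a) = 2)) :: 'a::nontriv lie set)"
proof -
  have iff: "(xd \<Lambda> k :: 'a lie) \<in> chain n 1 \<longleftrightarrow>
      xd \<Lambda> k \<in> (level n (n - 1 - of_bool (CARD('a) = 2)) :: 'a lie set)" (is "?N \<longleftrightarrow> ?L")
    if basis: "xd \<Lambda> k \<in> (basis n :: 'a lie set)" for \<Lambda> k
  proof -
    have k: "1 \<le> k" "k \<le> n" and \<Lambda>: "\<And>i. Poly_Mapping.lookup \<Lambda> i < CARD('a)"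
      using basis by (auto simp: xd_basis_iff)
    have "?N \<longleftrightarrow> affine \<Lambda>"
    proof
      assume N: ?N
      show "affine \<Lambda>"
      proof (cases "\<Lambda> = 0")
        case False
        then obtain j where j: "j \<in> Poly_Mapping.keys \<Lambda>" by (metis all_not_in_conv keys_eq_empty)
        then have "j \<in> {1..<k}" using basis by (auto simp: xd_basis_iff)
        then have j': "1 \<le> j" "j \<le> n" "1 \<le> Poly_Mapping.lookup \<Lambda> j"
          using j k by (auto simp: in_keys_iff)
        have "xd (\<Lambda> - part j + 0) k \<in> (chain n 0 :: 'a lie set)"
          using N j' \<Lambda> by (intro basis_normalizerD(1)[OF _ chain_subset, of _ _ _ 0])
            (auto simp: lookup_minus less_imp_diff_less xd_in_chain_0_iff simp del: chain.simps(1))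
        then have "\<Lambda> - part j = 0" by (simp only: xd_in_chain_0_iff) simp
        then show ?thesis using remove_part[OF j'(3)] by (metis add_0 affine_def)
      qed (simp add: affine_def)
    next
      assume "affine \<Lambda>"
      then show ?N
        unfolding One_nat_def chain.simps(2) xd_in_basis_normalizer_iff[OF chain_subset] xd_in_chain_0_iff
        using basis k affine_remove_part[of \<Lambda>] by fastforce
    qed
    moreover have "?L \<longleftrightarrow> affine \<Lambda>"
      using basis k assms affine_if_wt_small[OF basis] by (auto simp: xd_in_level_iff)
    ultimately show ?thesis by simp
  qed
  show ?thesis
  proof (rule Set.set_eqI)
    fix b :: "'a lie"
    show "b \<in> chain n 1 \<longleftrightarrow> b \<in> level n (n - 1 - of_bool (CARD('a) = 2))"
    proof (cases "b \<in> basis n")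
      case True
      then obtain \<Lambda> k where "b = xd \<Lambda> k" by (auto simp: basis_def)
      then show ?thesis using iff True by blast
    next
      case False
      then show ?thesis using chain_subset level_subset by blast
    qed
  qed
qed

text \<open>The entry \<open>Suc i\<close> of \<open>chain\<close> is N_i. Each idealizer lowers the
  degree bound by one, reaching \<open>level n 0\<close> at i = n - 1 - delta.\<close>

lemma chain_eq_level:
  assumes "i + 1 + of_bool (CARD('a) = 2) \<le> n"
  shows "chain n (Suc i) = (level n (n - 1 - of_bool (CARD('a) = 2) - i) :: 'a::nontriv lie set)"
  using assms
proof (induction i)
  case 0
  then show ?case using chain_1[of n, where 'a='a] by (simp only: add_0 One_nat_def diff_zero)
next
  case (Suc i)
  let ?t = "n - 1 - of_bool (CARD('a) = 2) - i"
  have IH: "chain n (Suc i) = (level n ?t :: 'a lie set)"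
    using Suc.prems by (intro Suc.IH) linarith
  have "chain n (Suc (Suc i)) = basis_normalizer n (level n ?t :: 'a lie set)"
    by (subst chain.simps(2)) (simp only: IH)
  also have "\<dots> = level n (?t - 1)" using Suc.prems by (intro basis_normalizer_level) auto
  finally show ?case by (simp only: diff_diff_left Suc_eq_plus1 add.assoc)
qed

text \<open>The same three moves apply. Affine elements have positive degree, so at t = 0 an affine
  result satisfies the weight bound as well and no exceptional monomials arise.\<close>

lemma normalizer_level_0_wt:
  assumes "xd \<Lambda> k \<in> basis_normalizer n (level n 0 :: 'a::nontriv lie set)"
  shows "wt \<Lambda> \<le> k + 1"
proof -
  have wt_le: "wt \<Theta> \<le> j" if "xd \<Theta> j \<in> (level n 0 :: 'a lie set)" for \<Theta> j
    using that affine_wt_less[of \<Theta> j n, where 'a='a] by (auto simp: xd_in_level_iff)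
  note basis = normalizer_basis[OF assms]
  consider "k < n" | "1 \<le> Poly_Mapping.lookup \<Lambda> 1" | "\<Lambda> \<noteq> 0" "Poly_Mapping.lookup \<Lambda> 1 = 0" | "\<Lambda> = 0"
    by force
  then show ?thesis
  proof cases
    case 1
    then show ?thesis using normalizer_raise[OF assms] wt_le by blast
  next
    case 2
    then show ?thesis using wt_le[OF normalizer_drop[OF assms 2]] wt_remove_part[OF 2] by simp
  next
    case 3
    from assms 3 obtain i where i: "1 \<le> Poly_Mapping.lookup \<Lambda> (i + 1)"
      "xd (\<Lambda> - part (i + 1) + part i) k \<in> (level n 0 :: 'a lie set)"
      by (rule normalizer_shift_least)
    then show ?thesis using wt_le[OF i(2)] wt_shift[OF i(1)] by simp
  qed simp
qed

section \<open>Refinability and the first excludant\<close>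

text \<open>Comparing with the least excludant is comparing with all of them. If there is none, the
  default n gives n < k + n, true for k >= 1, and the right side is vacuous.\<close>

lemma excludant_condition_1_iff:
  assumes "1 \<le> k"
  shows "excludant_condition m n 1 \<Lambda> k \<longleftrightarrow>
     (\<forall>i. 1 \<le> i \<and> i < n \<and> Poly_Mapping.lookup \<Lambda> i < m - 1 \<longrightarrow> n < k + i)"
proof -
  define E where "E = Poly_Mapping.keys (complement m n \<Lambda>)"
  have "Poly_Mapping.lookup (\<Sum>i\<in>S. Poly_Mapping.single i (m - 1)) j = (if j \<in> S then m - 1 else 0)"
    if "finite S" for S and j :: nat
    using that by (induction S) (auto simp: lookup_add lookup_single when_def)
  then have "Poly_Mapping.lookup (complement m n \<Lambda>) j
      = (if 1 \<le> j \<and> j < n then m - 1 - Poly_Mapping.lookup \<Lambda> j else 0)" for j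
    by (simp add: complement_def lookup_minus)
  then have E: "i \<in> E \<longleftrightarrow> 1 \<le> i \<and> i < n \<and> Poly_Mapping.lookup \<Lambda> i < m - 1" for i
    by (auto simp: E_def in_keys_iff)
  have fin: "finite E" by (simp add: E_def)
  have "excludant m n \<Lambda> 1 = (if E = {} then n else Min E)"
  proof (cases "E = {}")
    case False
    then show ?thesis
      using fin by (simp add: excludant_def excludants_def E_def[symmetric] Suc_le_eq card_gt_0_iff
          sorted_list_of_set_nonempty)
  qed (simp add: excludant_def excludants_def E_def[symmetric])
  then have "excludant_condition m n 1 \<Lambda> k \<longleftrightarrow> n < k + (if E = {} then n else Min E)"
    by (auto simp: excludant_condition_def)
  also have "\<dots> \<longleftrightarrow> (\<forall>i\<in>E. n < k + i)"
  proof (cases "E = {}")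
    case False
    then have "Min E \<in> E" "\<forall>i\<in>E. Min E \<le> i" using fin by auto
    then show ?thesis using False by (force intro: less_le_trans)
  qed (use assms in simp)
  finally show ?thesis by (auto simp: E)
qed

text \<open>For m = 2, where multiplicity 1 is full, this shows that a partition of k + 1 into parts
  below k misses one of them.\<close>

lemma wt_full:
  assumes "Poly_Mapping.keys \<Lambda> \<subseteq> {1..<k}" "\<And>i. 1 \<le> i \<Longrightarrow> i < k \<Longrightarrow> Poly_Mapping.lookup \<Lambda> i = 1"
  shows "2 * wt \<Lambda> = k * (k - 1)"
proof -
  have "wt \<Lambda> = (\<Sum>i\<in>{1..<k}. i)"
    using assms by (subst wt_superset[of "{1..<k}"]) auto
  moreover have "2 * (\<Sum>i\<in>{1..<k}. i) = k * (k - 1)"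
    by (induction k) (auto simp: algebra_simps)
  ultimately show ?thesis by simp
qed

text \<open>The pieces replacing a part j form a partition \<Theta> of j into smaller parts, that
  is, a degree zero element whose bracket survives truncation.\<close>

lemma refinable_iff:
  assumes "xd \<Lambda> k \<in> (basis n :: 'a::nontriv lie set)"
  shows "refinable (CARD('a)) \<Lambda> \<longleftrightarrow> (\<exists>\<Theta> j. xd \<Theta> j \<in> (basis n :: 'a lie set) \<and> wt \<Theta> = j \<and>
     1 \<le> Poly_Mapping.lookup \<Lambda> j \<and> (\<forall>i. Poly_Mapping.lookup (\<Lambda> - part j + \<Theta>) i < CARD('a)))"
    (is "_ \<longleftrightarrow> ?R")
proof
  have lt: "Poly_Mapping.lookup \<Lambda> i < CARD('a)" for i using assms by (simp add: xd_basis_iff)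
  {
    assume "refinable (CARD('a)) \<Lambda>"
    then obtain j J a where j: "1 \<le> Poly_Mapping.lookup \<Lambda> j" and J: "J \<subseteq> {1..<j}"
      and a: "\<And>i. i \<in> J \<Longrightarrow> 1 \<le> a i \<and> a i \<le> CARD('a) - 1 - Poly_Mapping.lookup \<Lambda> i"
      and sum: "j = (\<Sum>i\<in>J. a i * i)"
      unfolding refinable_def by blast
    have fin: "finite J" using J finite_subset by blast
    have jk: "1 \<le> j" "j < k" "k \<le> n"
      using j assms by (auto simp: xd_basis_iff in_keys_iff subset_iff)
    define \<Theta> where "\<Theta> = (\<Sum>i\<in>J. Poly_Mapping.single i (a i))"
    have "Poly_Mapping.lookup (\<Sum>i\<in>S. Poly_Mapping.single i (a i)) l = (if l \<in> S then a l else 0)"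
      if "finite S" for S l
      using that by (induction S) (auto simp: lookup_add lookup_single when_def)
    then have \<Theta>: "Poly_Mapping.lookup \<Theta> l = (if l \<in> J then a l else 0)" for l
      using fin by (simp add: \<Theta>_def)
    then have keys: "Poly_Mapping.keys \<Theta> \<subseteq> J" by (auto simp: in_keys_iff split: if_splits)
    have "wt \<Theta> = j"
      using sum \<Theta> by (simp add: wt_superset[OF fin keys] mult.commute)
    moreover have lt': "Poly_Mapping.lookup \<Lambda> l + Poly_Mapping.lookup \<Theta> l < CARD('a)" for l
      using a[of l] lt[of l] by (auto simp: \<Theta>)
    then have "Poly_Mapping.lookup (\<Lambda> - part j + \<Theta>) l < CARD('a)" for l
      by (intro le_less_trans[OF _ lt'[of l]]) (simp add: lookup_add lookup_minus)
    moreover have "xd \<Theta> j \<in> (basis n :: 'a lie set)"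
      using keys J jk lt' by (auto simp: xd_basis_iff intro: le_less_trans[OF le_add2])
    ultimately show ?R using j by blast
  }
  assume ?R
  then obtain \<Theta> j where \<Theta>: "xd \<Theta> j \<in> (basis n :: 'a lie set)" "wt \<Theta> = j"
    and j: "1 \<le> Poly_Mapping.lookup \<Lambda> j"
    and red: "\<And>i. Poly_Mapping.lookup (\<Lambda> - part j + \<Theta>) i < CARD('a)" by blast
  have "\<Lambda> \<in> partitions_upto (CARD('a)) (k - 1)"
    using assms by (auto simp: basis_def)
  then have "\<Lambda> \<in> partitions (CARD('a))" by (auto simp: partitions_def)
  moreover have "Poly_Mapping.keys \<Theta> \<subseteq> {1..<j}" using \<Theta> by (simp add: xd_basis_iff)
  moreover have "1 \<le> Poly_Mapping.lookup \<Theta> i \<and>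
      Poly_Mapping.lookup \<Theta> i \<le> CARD('a) - 1 - Poly_Mapping.lookup \<Lambda> i"
    if i: "i \<in> Poly_Mapping.keys \<Theta>" for i
  proof -
    \<comment> \<open>Removing j leaves the multiplicity at i unchanged, so surviving truncation is
      exactly the bound on a_i.\<close>
    have "i \<noteq> j" using i \<open>Poly_Mapping.keys \<Theta> \<subseteq> {1..<j}\<close> by auto
    then show ?thesis using i red[of i]
      by (auto simp: in_keys_iff lookup_add lookup_minus lookup_single when_def)
  qed
  moreover have "j = (\<Sum>i\<in>Poly_Mapping.keys \<Theta>. Poly_Mapping.lookup \<Theta> i * i)"
    using \<Theta>(2) by (simp add: wt_def mult.commute)
  ultimately show "refinable (CARD('a)) \<Lambda>" unfolding refinable_def using j by blast
qed

text \<open>If k + i <= n, the bracket with the degree zero element x_k x_i d_(k+i) adds a part i to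
  \<Lambda> and has degree -1, outside \<open>level n 0\<close>.\<close>

lemma normalizer_level_0_excludant:
  assumes norm: "xd \<Lambda> k \<in> basis_normalizer n (level n 0 :: 'a::nontriv lie set)"
    and wt: "wt \<Lambda> = k + 1"
    and i: "1 \<le> i" "Poly_Mapping.lookup \<Lambda> i < CARD('a) - 1"
  shows "n < k + i"
proof (rule ccontr)
  assume "\<not> n < k + i"
  then have kin: "k + i \<le> n" by simp
  note basis = normalizer_basis[OF norm]
  have k: "1 \<le> k" "Poly_Mapping.keys \<Lambda> \<subseteq> {1..<k}"
    and lt: "\<And>j. Poly_Mapping.lookup \<Lambda> j < CARD('a)" using basis by (auto simp: xd_basis_iff)
  \<comment> \<open>The natural witness \<open>x\<^sub>k x\<^sub>i \<partial>\<^bsub>k+i\<^esub>\<close> vanishes for \<open>m = 2\<close> and \<open>i = k\<close>. Then a smaller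
      \<open>i'\<close> is available, since \<open>1 + \<dots> + (k - 1) = k + 1\<close> has no solution.\<close>
  have "\<exists>i'. 1 \<le> i' \<and> i' \<le> i \<and> Poly_Mapping.lookup \<Lambda> i' < CARD('a) - 1 \<and> (i' = k \<longrightarrow> CARD('a) \<noteq> 2)"
  proof (cases "i = k \<and> CARD('a) = 2")
    case True
    have "\<exists>i'. 1 \<le> i' \<and> i' < k \<and> Poly_Mapping.lookup \<Lambda> i' \<noteq> 1"
    proof (rule ccontr)
      assume "\<not> ?thesis"
      then have "2 * wt \<Lambda> = k * (k - 1)" using k(2) by (intro wt_full) auto
      with wt have eq: "k * (k - 1) = 2 * k + 2" by simp
      \<comment> \<open>For k = 1, 2, 3 the sides of \<open>eq\<close> are 0, 2, 6 and 4, 6, 8; from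
        4 on the left side is larger.\<close>
      have "k \<ge> 4 \<or> k = 1 \<or> k = 2 \<or> k = 3" using k(1) by auto
      moreover have "k * (k - 1) \<ge> 2 * k + 4" if "k \<ge> 4"
      proof -
        have "k * (k - 1) \<ge> k * 3" using that by (intro mult_le_mono2) simp
        then show ?thesis using that by linarith
      qed
      ultimately show False using eq by auto
    qed
    then obtain i' where "1 \<le> i'" "i' < k" "Poly_Mapping.lookup \<Lambda> i' \<noteq> 1" by blast
    then show ?thesis using True lt[of i'] by (intro exI[of _ i']) auto
  qed (use i in auto)
  then obtain i' where i': "1 \<le> i'" "i' \<le> i" "Poly_Mapping.lookup \<Lambda> i' < CARD('a) - 1"
    "i' = k \<longrightarrow> CARD('a) \<noteq> 2" by blast
  have "xd (part k + part i') (k + i') \<in> (basis n :: 'a lie set)"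
    unfolding xd_basis_iff
  proof (intro conjI allI)
    show "Poly_Mapping.keys (part k + part i') \<subseteq> {1..<k + i'}"
      using keys_add[of "part k" "part i'"] k(1) i'(1) by auto
    show "Poly_Mapping.lookup (part k + part i') l < CARD('a)" for l
      using i'(4) nontriv[where 'a='a] by (auto simp: lookup_add lookup_single when_def)
  qed (use k i' kin in auto)
  then have "xd (part k + part i') (k + i') \<in> (level n 0 :: 'a lie set)"
    by (simp add: xd_in_level_iff wt_add)
  moreover have "Poly_Mapping.lookup (part k + part i' - part k + \<Lambda>) l < CARD('a)" for l
    using lt[of l] i'(3) by (auto simp: lookup_add lookup_single when_def)
  ultimately have "xd (part i' + \<Lambda>) (k + i') \<in> (level n 0 :: 'a lie set)"
    using basis_normalizerD(2)[OF norm level_subset, of "part k + part i'" "k + i'"]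
    by (simp add: lookup_add)
  then show False
    using affine_wt_less[of "part i' + \<Lambda>" "k + i'" n, where 'a='a] wt
    by (auto simp: xd_in_level_iff wt_add)
qed

lemma basis_normalizer_level_0_iff:
  "xd \<Lambda> k \<in> basis_normalizer n (level n 0) - (level n 0 :: 'a::nontriv lie set) \<longleftrightarrow>
     xd \<Lambda> k \<in> (basis n :: 'a lie set) \<and> wt \<Lambda> = k + 1 \<and> \<not> refinable (CARD('a)) \<Lambda> \<and>
     excludant_condition (CARD('a)) n 1 \<Lambda> k"
  (is "?N \<longleftrightarrow> _ \<and> ?W \<and> ?U \<and> ?E")
proof (cases "xd \<Lambda> k \<in> (basis n :: 'a lie set)")
  case basis: True
  then have k: "1 \<le> k" by (simp add: xd_basis_iff)
  \<comment> \<open>Affine basis elements have positive degree, so \<open>level n 0\<close> is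
    described by the degree alone.\<close>
  have level_iff: "xd \<Theta> j \<in> (level n 0 :: 'a lie set) \<longleftrightarrow> wt \<Theta> \<le> j"
    if "xd \<Theta> j \<in> (basis n :: 'a lie set)" for \<Theta> j
    using that affine_wt_less[OF _ that] by (auto simp: xd_in_level_iff)
  show ?thesis
  proof
    assume ?N
    then have norm: "xd \<Lambda> k \<in> basis_normalizer n (level n 0 :: 'a lie set)"
      and "xd \<Lambda> k \<notin> (level n 0 :: 'a lie set)" by auto
    then have wt: "wt \<Lambda> = k + 1"
      using normalizer_level_0_wt[OF norm] level_iff[OF basis] by simp
    moreover have ?U
    proof
      assume "refinable (CARD('a)) \<Lambda>"
      then obtain \<Theta> j where \<Theta>: "xd \<Theta> j \<in> (basis n :: 'a lie set)" "wt \<Theta> = j"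
        and j: "1 \<le> Poly_Mapping.lookup \<Lambda> j"
        and red: "\<forall>i. Poly_Mapping.lookup (\<Lambda> - part j + \<Theta>) i < CARD('a)"
        unfolding refinable_iff[OF basis] by blast
      have "xd (\<Lambda> - part j + \<Theta>) k \<in> (level n 0 :: 'a lie set)"
        using basis_normalizerD(1)[OF norm level_subset _ j] red \<Theta> level_iff by auto
      then have "wt (\<Lambda> - part j + \<Theta>) \<le> k"
        using level_iff xd_bracket_in_basis[OF basis \<Theta>(1) j red] by blast
      then show False using wt wt_remove_part[OF j] \<Theta>(2) by (simp add: wt_add)
    qed
    moreover have ?E
      unfolding excludant_condition_1_iff[OF k] using normalizer_level_0_excludant[OF norm wt] by blast
    ultimately show "xd \<Lambda> k \<in> (basis n :: 'a lie set) \<and> ?W \<and> ?U \<and> ?E" using basis by blast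
  next
    assume R: "xd \<Lambda> k \<in> (basis n :: 'a lie set) \<and> ?W \<and> ?U \<and> ?E"
    then have wt: "wt \<Lambda> = k + 1" by blast
    have "xd \<Lambda> k \<in> basis_normalizer n (level n 0 :: 'a lie set)"
      unfolding xd_in_basis_normalizer_iff[OF level_subset]
    proof (intro conjI allI impI)
      fix \<Theta> j
      assume \<Theta>_level: "xd \<Theta> j \<in> (level n 0 :: 'a lie set)"
      then have \<Theta>: "xd \<Theta> j \<in> (basis n :: 'a lie set)" using level_subset by blast
      then have wt_\<Theta>: "wt \<Theta> \<le> j" using level_iff \<Theta>_level by blast
      show "xd (\<Lambda> - part j + \<Theta>) k \<in> (level n 0 :: 'a lie set)"
        if j: "1 \<le> Poly_Mapping.lookup \<Lambda> j"
          and red: "\<forall>i. Poly_Mapping.lookup (\<Lambda> - part j + \<Theta>) i < CARD('a)"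
      proof -
        \<comment> \<open>In degree zero \<Theta> would refine \<Lambda>. So its degree is at least
          1, which makes up for the degree -1 of \<Lambda>.\<close>
        have "wt \<Theta> \<noteq> j" using R refinable_iff[OF basis] \<Theta> j red by blast
        then show ?thesis
          using level_iff[OF xd_bracket_in_basis[OF basis \<Theta> j red]] wt_remove_part[OF j] wt wt_\<Theta>
          by (simp add: wt_add)
      qed
      show "xd (\<Theta> - part k + \<Lambda>) j \<in> (level n 0 :: 'a lie set)"
        if j: "1 \<le> Poly_Mapping.lookup \<Theta> k"
          and red: "\<forall>i. Poly_Mapping.lookup (\<Theta> - part k + \<Lambda>) i < CARD('a)"
      proof -
        let ?\<Theta> = "\<Theta> - part k"
        have kj: "k < j" "j \<le> n" using j \<Theta> by (auto simp: xd_basis_iff in_keys_iff subset_iff)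
        \<comment> \<open>Otherwise removing k from \<Theta> leaves parts of total weight j - k <= n
          - k. Such a part i has room in \<Lambda> by \<open>red\<close>, so the excludant condition
          demands n < k + i, a contradiction.\<close>
        have "wt \<Theta> \<noteq> j"
        proof
          assume "wt \<Theta> = j"
          then have wt': "wt ?\<Theta> + k = j" using wt_remove_part[OF j] by simp
          with kj(1) have "?\<Theta> \<noteq> 0" by auto
          then obtain i where i: "i \<in> Poly_Mapping.keys ?\<Theta>" by (metis all_not_in_conv keys_eq_empty)
          then have pos: "1 \<le> Poly_Mapping.lookup ?\<Theta> i" by (simp add: in_keys_iff)
          have "Poly_Mapping.lookup \<Theta> i \<noteq> 0" using pos by (auto simp: lookup_minus)
          then have "1 \<le> i" using \<Theta> by (auto simp: xd_basis_iff in_keys_iff subset_iff)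
          have "i * 1 \<le> i * Poly_Mapping.lookup ?\<Theta> i" using pos by (rule mult_le_mono2)
          also have "\<dots> \<le> wt ?\<Theta>" by (rule lookup_mult_le_wt)
          finally have "k + i \<le> n" using wt' kj by simp
          moreover have "Poly_Mapping.lookup \<Lambda> i < CARD('a) - 1"
            using red[rule_format, of i] pos by (simp add: lookup_add)
          ultimately show False
            using R \<open>1 \<le> i\<close> k unfolding excludant_condition_1_iff[OF k] by fastforce
        qed
        then show ?thesis
          using level_iff[OF xd_bracket_in_basis[OF \<Theta> basis j red]] wt_remove_part[OF j] wt wt_\<Theta>
          by (simp add: wt_add)
      qed
    qed (rule basis)
    then show ?N using wt level_iff[OF basis] by simp
  qed
qed (use basis_normalizer_subset[of n "level n 0 :: 'a lie set"] in blast)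

section \<open>The degenerate case n = 1 and the theorem\<close>

lemma basis_1: "basis 1 = {xd 0 1 :: 'a::nontriv lie}"
proof -
  have "\<Lambda> = 0 \<and> k = 1" if "xd \<Lambda> k \<in> (basis 1 :: 'a lie set)" for \<Lambda> k
    using that by (auto simp: xd_basis_iff)
  moreover have "xd 0 1 \<in> (basis 1 :: 'a lie set)" by (simp add: xd_basis_iff)
  moreover have "b \<in> range (\<lambda>(\<Lambda>, k). xd \<Lambda> k)" if "b \<in> (basis 1 :: 'a lie set)" for b
    using that by (auto simp: basis_def)
  ultimately show ?thesis by fast
qed

theorem theorem4p5:
  fixes m n :: nat
  assumes "m = CARD('a::nontriv)" and "m \<ge> 2" and "n \<ge> 1"
  shows "(idealizer n (int n - of_bool (m = 2)) :: 'a lie set)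
           - idealizer n (int n - 1 - of_bool (m = 2))
         = {xd \<Lambda> k | \<Lambda> k.
              (xd \<Lambda> k :: 'a lie) \<in> basis n \<and>
              \<Lambda> \<in> partitions_upto m (n - 1) \<and>
              wt \<Lambda> = k + 1 \<and>
              unrefinable m \<Lambda> \<and>
              excludant_condition m n 1 \<Lambda> k}"
    (is "?D = ?R")
proof -
  have R: "?R = {xd \<Lambda> k | \<Lambda> k. (xd \<Lambda> k :: 'a lie) \<in> basis n \<and> wt \<Lambda> = k + 1 \<and>
      \<not> refinable (CARD('a)) \<Lambda> \<and> excludant_condition (CARD('a)) n 1 \<Lambda> k}"
  proof -
    have "\<Lambda> \<in> partitions_upto m (n - 1) \<and> \<Lambda> \<in> partitions m"
      if "(xd \<Lambda> k :: 'a lie) \<in> basis n" for \<Lambda> k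
    proof -
      have "\<Lambda> \<in> partitions_upto m (k - 1)" "k \<le> n" using that assms(1) by (auto simp: basis_def)
      then show ?thesis by (fastforce simp: partitions_def partitions_upto_def)
    qed
    then show ?thesis using assms(1) unfolding unrefinable_def by blast
  qed
  show ?thesis
  proof (cases "1 + of_bool (m = 2) \<le> n")
    case True
    \<comment> \<open>The index at which N_i is \<open>level n 0\<close>.\<close>
    define i where "i = n - 1 - of_bool (m = 2)"
    have "nat (int n - of_bool (m = 2) + 1) = Suc (Suc i)" "nat (int n - 1 - of_bool (m = 2) + 1) = Suc i"
      using True by (auto simp: i_def of_bool_def)
    moreover have "chain n (Suc i) = (level n 0 :: 'a lie set)"
      using chain_eq_level[of i n, where 'a='a] True assms(1) by (auto simp: i_def)
    ultimately have D: "?D = basis_normalizer n (level n 0) - (level n 0 :: 'a lie set)"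
      by (simp add: idealizer_def)
    have "b \<in> ?D \<Longrightarrow> \<exists>\<Lambda> k. b = xd \<Lambda> k" for b
      unfolding D using basis_normalizer_subset by (fastforce simp: basis_def)
    then show ?thesis
      unfolding R using basis_normalizer_level_0_iff[of _ _ n, where 'a='a] unfolding D
      by (intro Set.set_eqI) blast
  next
    \<comment> \<open>Here the subtracted term is \<open>\<N>\<^bsub>-1\<^esub> = \<T>\<close>, which is all of \<open>\<B>\<close>.\<close>
    case False
    then have n: "n = 1" "m = 2" using assms(3) by (auto split: if_splits simp: of_bool_def)
    have "chain 1 0 = (basis 1 :: 'a lie set)" unfolding basis_1 by auto
    then have "?D = {}"
      using chain_subset[of 1 1, where 'a='a] by (auto simp: n idealizer_def)
    \<comment> \<open>The only basis element is d_1, whose partition has weight 0 instead of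
      2.\<close>
    moreover have "?R = {}" unfolding R n basis_1 by auto
    ultimately show ?thesis by (simp only:)
  qed
qed

end
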